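(* Let $L$ be a non-characteristically nilpotent filiform Leibniz algebra of the family $F_1(\alpha_3,\alpha_4,\dots,\alpha_n,\alpha_n)$ (that is, of the family $F_1(\alpha_3,\dots,\alpha_n,\theta)$ with $\theta=\alpha_n$). Then $L$ is isomorphic to one of the following pairwise non-isomorphic algebras: $$F_1^{s}(\alpha_3,\alpha_4,\dots,\alpha_n,\alpha_n),\qquad 3\le s\le n,$$ where, for $3\le k\le n$, $$\alpha_k=\begin{cases}0, & \text{if } k\not\equiv s \pmod{s-2},\\ (-1)^t\,C^{s-1}_{t+1}, & \text{if } k\equiv s \pmod{s-2},\ \text{for } t=\frac{k-s}{s-2},\end{cases}$$ and $C^{p}_{m}=\frac{1}{(p-1)m+1}\binom{pm}{m}$ is the $p$-th Catalan number. Here $F_1^s(\alpha_3,\dots,\alpha_n,\alpha_n)$ denotes the algebra $F_1(\alpha_3,\dots,\alpha_n,\theta)$ with these values of $\alpha_3,\dots,\alpha_n$ and $\theta=\alpha_n$.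
   Context: A Leibniz algebra is a vector space with a bilinear bracket satisfying $[[x,y],z]=[[x,z],y]+[x,[y,z]]$. A derivation of a Leibniz algebra $L$ is a linear map $d:L\to L$ with $d([x,y])=[d(x),y]+[x,d(y)]$. With $L^1=L$, $L^{k+1}=[L^k,L]$, $L$ is nilpotent if $L^m=0$ for some $m$, and an algebra $L$ of dimension $N$ is filiform if $\dim L^i=N-i$ for $2\le i\le N$. A nilpotent Leibniz algebra is characteristically nilpotent if all its derivations are nilpotent linear maps, and non-characteristically nilpotent if it is nilpotent but admits a non-nilpotent derivation. For complex parameters, $F_1(\alpha_3,\dots,\alpha_n,\theta)$ denotes the $(n+1)$-dimensional complex filiform Leibniz algebra with basis $\{e_0,e_1,\dots,e_n\}$ and products $[e_0,e_0]=e_2$; $[e_i,e_0]=e_{i+1}$ for $1\le i\le n-1$; $[e_0,e_1]=\sum_{k=3}^{n-1}\alpha_ke_k+\theta e_n$; $[e_i,e_1]=\sum_{k=i+2}^n\alpha_{k+1-i}e_k$ for $1\le i\le n-2$; all other products of basis elements are zero.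
   Formalization: The formal theorem additionally assumes that some α_k (3 ≤ k ≤ n) is nonzero for the existence part; F_1(0,…,0,0) satisfies the stated hypotheses but is isomorphic to none of the F_1^s. *)

theory Defs
  imports Complex_Main "HOL-Library.Function_Algebras" "HOL-Number_Theory.Cong"
begin

text \<open>
  An algebra is carried by a subspace of an ambient vector space given by a type 'v and a
  scalar multiplication. The ambient space is needed because the dimension \<open>n + 1\<close> of the
  algebras below is a term; an algebra on a whole type is the case \<open>carrier L = UNIV\<close>.
\<close>

record ('k, 'v) alg =
  carrier :: "'v set"
  smul :: "'k \<Rightarrow> 'v \<Rightarrow> 'v"
  bracket :: "'v \<Rightarrow> 'v \<Rightarrow> 'v"

definition linear_on :: "('k, 'v::plus) alg \<Rightarrow> ('k, 'w::plus) alg \<Rightarrow> ('v \<Rightarrow> 'w) \<Rightarrow> bool" where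
  "linear_on L M f \<longleftrightarrow>
     f ` carrier L \<subseteq> carrier M \<and>
     (\<forall>x\<in>carrier L. \<forall>y\<in>carrier L. f (x + y) = f x + f y) \<and>
     (\<forall>c. \<forall>x\<in>carrier L. f (smul L c x) = smul M c (f x))"

definition leibniz_algebra :: "('k::field, 'v::ab_group_add) alg \<Rightarrow> bool" where
  "leibniz_algebra L \<longleftrightarrow>
     vector_space (smul L) \<and> module.subspace (smul L) (carrier L) \<and>
     (\<forall>x\<in>carrier L. linear_on L L (bracket L x)) \<and>
     (\<forall>y\<in>carrier L. linear_on L L (\<lambda>x. bracket L x y)) \<and>
     (\<forall>x\<in>carrier L. \<forall>y\<in>carrier L. \<forall>z\<in>carrier L.
        bracket L (bracket L x y) z = bracket L (bracket L x z) y + bracket L x (bracket L y z))"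

definition isomorphic ::
  "('k::field, 'v::ab_group_add) alg \<Rightarrow> ('k, 'w::ab_group_add) alg \<Rightarrow> bool" where
  "isomorphic L M \<longleftrightarrow>
     (\<exists>f. linear_on L M f \<and> bij_betw f (carrier L) (carrier M) \<and>
          (\<forall>x\<in>carrier L. \<forall>y\<in>carrier L. f (bracket L x y) = bracket M (f x) (f y)))"

definition derivation :: "('k::field, 'v::ab_group_add) alg \<Rightarrow> ('v \<Rightarrow> 'v) \<Rightarrow> bool" where
  "derivation L d \<longleftrightarrow> linear_on L L d \<and>
     (\<forall>x\<in>carrier L. \<forall>y\<in>carrier L. d (bracket L x y) = bracket L (d x) y + bracket L x (d y))"

definition nilpotent_map :: "('k::field, 'v::ab_group_add) alg \<Rightarrow> ('v \<Rightarrow> 'v) \<Rightarrow> bool" where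
  "nilpotent_map L d \<longleftrightarrow> (\<exists>m. \<forall>x\<in>carrier L. (d ^^ m) x = 0)"

text \<open>The series starts at \<open>L\<^sup>1 = L\<close>; the value at index \<open>0\<close> is a dummy.\<close>

fun lower_central :: "('k::field, 'v::ab_group_add) alg \<Rightarrow> nat \<Rightarrow> 'v set" where
  "lower_central L 0 = carrier L"
| "lower_central L (Suc 0) = carrier L"
| "lower_central L (Suc (Suc k)) =
     module.span (smul L) {bracket L x y | x y. x \<in> lower_central L (Suc k) \<and> y \<in> carrier L}"

definition nilpotent_alg :: "('k::field, 'v::ab_group_add) alg \<Rightarrow> bool" where
  "nilpotent_alg L \<longleftrightarrow> (\<exists>m\<ge>1. lower_central L m = {0})"

text \<open>
  Finite dimension is required explicitly, since \<^const>\<open>vector_space.dim\<close> is \<open>0\<close> on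
  infinite-dimensional spaces.
\<close>

definition filiform :: "('k::field, 'v::ab_group_add) alg \<Rightarrow> bool" where
  "filiform L \<longleftrightarrow>
     (\<exists>B. finite B \<and> module.span (smul L) B = carrier L) \<and>
     (\<forall>i. 2 \<le> i \<and> i \<le> vector_space.dim (smul L) (carrier L) \<longrightarrow>
        vector_space.dim (smul L) (lower_central L i) =
        vector_space.dim (smul L) (carrier L) - i)"

definition non_characteristically_nilpotent ::
  "('k::field, 'v::ab_group_add) alg \<Rightarrow> bool" where
  "non_characteristically_nilpotent L \<longleftrightarrow>
     nilpotent_alg L \<and> (\<exists>d. derivation L d \<and> \<not> nilpotent_map L d)"

text \<open>
  Coordinate vectors are functions \<^typ>\<open>nat \<Rightarrow> complex\<close> with the pointwise operations; the
  algebra \<open>F\<^sub>1(\<alpha>\<^sub>3, \<dots>, \<alpha>\<^sub>n, \<theta>)\<close> lives on those supported on \<open>{0..n}\<close>.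
\<close>

definition scale_fun :: "complex \<Rightarrow> (nat \<Rightarrow> complex) \<Rightarrow> (nat \<Rightarrow> complex)" where
  "scale_fun c v = (\<lambda>i. c * v i)"

definition basis_vec :: "nat \<Rightarrow> (nat \<Rightarrow> complex)" where
  "basis_vec i = (\<lambda>j. if j = i then 1 else 0)"

text \<open>\<open>F1_table n \<alpha> \<theta> i j\<close> is the product of the basis elements \<open>e\<^sub>i\<close> and \<open>e\<^sub>j\<close>.\<close>

definition F1_table ::
  "nat \<Rightarrow> (nat \<Rightarrow> complex) \<Rightarrow> complex \<Rightarrow> nat \<Rightarrow> nat \<Rightarrow> (nat \<Rightarrow> complex)" where
  "F1_table n \<alpha> \<theta> i j =
     (if i = 0 \<and> j = 0 then basis_vec 2
      else if 1 \<le> i \<and> i \<le> n - 1 \<and> j = 0 then basis_vec (i + 1)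
      else if i = 0 \<and> j = 1 then
        (\<Sum>k = 3..n - 1. scale_fun (\<alpha> k) (basis_vec k)) + scale_fun \<theta> (basis_vec n)
      else if 1 \<le> i \<and> i \<le> n - 2 \<and> j = 1 then
        (\<Sum>k = i + 2..n. scale_fun (\<alpha> (k + 1 - i)) (basis_vec k))
      else 0)"

definition F1 :: "nat \<Rightarrow> (nat \<Rightarrow> complex) \<Rightarrow> complex \<Rightarrow> (complex, nat \<Rightarrow> complex) alg" where
  "F1 n \<alpha> \<theta> =
     \<lparr>carrier = {v. \<forall>i>n. v i = 0},
      smul = scale_fun,
      bracket = (\<lambda>x y. \<Sum>i\<le>n. \<Sum>j\<le>n. scale_fun (x i * y j) (F1_table n \<alpha> \<theta> i j))\<rparr>"

definition catalan :: "nat \<Rightarrow> nat \<Rightarrow> complex" where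
  "catalan p m = 1 / of_nat ((p - 1) * m + 1) * of_nat ((p * m) choose m)"

text \<open>
  The quotient is exact and the subtraction does not truncate: \<open>3 \<le> k\<close> and
  \<open>[k = s] (mod s - 2)\<close> imply \<open>s \<le> k\<close>.
\<close>

definition catalan_param :: "nat \<Rightarrow> nat \<Rightarrow> complex" where
  "catalan_param s k =
     (if [k = s] (mod (s - 2))
      then let t = (k - s) div (s - 2) in (-1) ^ t * catalan (s - 1) (t + 1)
      else 0)"

text \<open>
  For \<open>3 \<le> s \<le> n\<close> the first nonzero parameter of \<open>F1s n s\<close> is \<open>\<alpha>\<^sub>s = 1\<close>. The algebra
  \<open>F\<^sub>1(0, \<dots>, 0, 0)\<close>, which is also filiform and non-characteristically nilpotent, is
  isomorphic to none of them: its right annihilator is \<open>\<langle>e\<^sub>1, \<dots>, e\<^sub>n\<rangle>\<close>, that of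
  \<open>F1s n s\<close> is \<open>\<langle>e\<^sub>2, \<dots>, e\<^sub>n\<rangle>\<close>. So a classification by the \<open>F1s n s\<close> needs some
  \<open>\<alpha>\<^sub>k\<close> to be nonzero.
\<close>

definition F1s :: "nat \<Rightarrow> nat \<Rightarrow> (complex, nat \<Rightarrow> complex) alg" where
  "F1s n s = F1 n (catalan_param s) (catalan_param s n)"

end

theory Submission
  imports Defs "HOL-Computational_Algebra.Formal_Power_Series" "HOL-Library.Product_Plus"
begin

text \<open>
  Put \<open>A(X) = \<Sum> \<alpha>\<^sub>k X\<^bsup>k-1\<^esup>\<close> and identify \<open>e\<^sub>i\<close> with \<open>X\<^bsup>i-1\<^esup>\<close> for \<open>i \<ge> 1\<close>. When \<open>\<theta> = \<alpha>\<^sub>n\<close>, the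
  element \<open>f\<^sub>0 = e\<^sub>0 - e\<^sub>1\<close> satisfies \<open>[f\<^sub>0, L] = 0\<close>, and on \<open>\<complex>[X] / X\<^sup>n\<close> right multiplication by
  \<open>f\<^sub>0\<close> and by \<open>e\<^sub>1\<close> is multiplication by \<open>u = X - A\<close> and by \<open>A\<close>. Taking \<open>u\<close> as the new variable,
  right multiplication by \<open>f\<^sub>0\<close> becomes multiplication by \<open>u\<close> and the algebra is determined by
  the series \<open>B(u) = A(X)\<close>.

  Up to \<open>u\<^bsup>n-1\<^esup>\<close>, the line of \<open>f\<^sub>0\<close> is the left annihilator. So a derivation sends \<open>f\<^sub>0\<close> to
  \<open>a f\<^sub>0 + c u\<^bsup>n-1\<^esup>\<close> and \<open>1\<close> to some \<open>q(u)\<close>, and compatibility with \<open>[1, 1] = B\<close> reads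
  \<open>a i b\<^sub>i = q(0) b\<^sub>i\<close> for every coefficient \<open>b\<^sub>i\<close> of \<open>B\<close>. A non-nilpotent derivation therefore
  forces \<open>B\<close> to be a monomial, which rescaling of \<open>1\<close> turns into \<open>u\<^bsup>s-1\<^esup>\<close>. In the old variable
  this says \<open>A = (X - A)\<^bsup>s-1\<^esup>\<close>, so \<open>X - A\<close> is the compositional inverse of \<open>X + X\<^bsup>s-1\<^esup>\<close>, whose
  coefficients are the Catalan numbers by Lagrange inversion.
\<close>

unbundle fps_syntax

subsection \<open>Lagrange inversion\<close>

text \<open>As \<open>g\<close> has no constant term, \<open>g ^ i\<close> starts in degree
  \<open>i\<close> or later. Up to degree \<open>N\<close> the composition is therefore a finite
  combination of powers of \<open>g\<close>.\<close>

lemma fps_compose_mult_nth: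
  fixes a g F :: "'a::idom fps"
  assumes "g $ 0 = 0"
  shows "((a oo g) * F) $ N = (\<Sum>i\<le>N. a $ i * (g ^ i * F) $ N)"
proof -
  have c: "(a oo g) $ k = (\<Sum>i\<le>N. a $ i * (g ^ i) $ k)" if "k \<le> N" for k
    unfolding fps_compose_nth using that startsby_zero_power_prefix[OF assms]
    by (intro sum.mono_neutral_left) auto
  have "((a oo g) * F) $ N = (\<Sum>k\<le>N. \<Sum>i\<le>N. a $ i * ((g ^ i) $ k * F $ (N - k)))"
    unfolding fps_mult_nth atLeast0AtMost
    by (intro sum.cong) (auto simp: c sum_distrib_right mult.assoc)
  also have "\<dots> = (\<Sum>i\<le>N. a $ i * (g ^ i * F) $ N)"
    by (subst sum.swap) (simp add: fps_mult_nth sum_distrib_left atLeast0AtMost)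
  finally show ?thesis .
qed

lemma fps_X_mult_deriv_nth: "(fps_X * fps_deriv f) $ k = of_nat k * f $ k"
  for f :: "'a::comm_ring_1 fps"
  by (cases k) simp_all

text \<open>The residue of \<open>g' / g ^ m\<close> for \<open>g = X * h\<close>, written without Laurent series.\<close>

lemma residue_deriv_div_power:
  fixes h :: "'a::field_char_0 fps"
  assumes h: "h $ 0 \<noteq> 0" and m: "m \<ge> 1"
  shows "((h + fps_X * fps_deriv h) * inverse h ^ m) $ (m - 1) = (if m = 1 then 1 else 0)"
proof (cases "m = 1")
  case True
  then show ?thesis using h by simp
next
  case False
  then obtain k where k: "m = Suc k" "k \<ge> 1" using m by (cases m) auto
  define H where "H = inverse h"
  have hH: "h * H = 1" using h by (simp add: H_def inverse_mult_eq_1')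
  have "fps_deriv H = - fps_deriv h * H ^ 2"
    unfolding H_def using h by (simp add: fps_inverse_deriv)
  \<comment> \<open>The power rule for \<open>H ^ k\<close>. It makes the degree \<open>k\<close>
    coefficient of \<open>X * h' * H ^ m\<close> the negative of that of \<open>H ^ k\<close>, which
    cancels the contribution of \<open>h * H ^ m = H ^ k\<close>.\<close>
  then have "fps_const (of_nat k) * (fps_X * fps_deriv h * H ^ m) = - (fps_X * fps_deriv (H ^ k))"
  proof -
    have "H ^ m = H ^ 2 * H ^ (k - 1)" using k by (simp flip: power_add)
    then show ?thesis
      by (simp add: fps_deriv_power \<open>fps_deriv H = _\<close> mult_ac)
  qed
  then have "of_nat k * ((fps_X * fps_deriv h * H ^ m) $ k) = - (fps_X * fps_deriv (H ^ k)) $ k"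
    by (metis fps_mult_left_const_nth)
  also have "\<dots> = - of_nat k * (H ^ k) $ k"
    by (simp add: fps_X_mult_deriv_nth)
  finally have "of_nat k * ((fps_X * fps_deriv h * H ^ m) $ k) = of_nat k * (- (H ^ k) $ k)"
    by simp
  then have "(fps_X * fps_deriv h * H ^ m) $ k = - (H ^ k) $ k"
    using k(2) by (subst (asm) mult_left_cancel) auto
  moreover have "h * H ^ m = H ^ k"
    using k hH by (metis mult.assoc mult_1 power_Suc)
  then have "(h + fps_X * fps_deriv h) * H ^ m = H ^ k + fps_X * fps_deriv h * H ^ m"
    by (simp add: distrib_right)
  ultimately show ?thesis
    using k by (simp add: H_def[symmetric])
qed

text \<open>Differentiating \<open>w oo g = X\<close> for \<open>g = X * h\<close> gives
  \<open>(w' oo g) * g' = 1\<close>. After multiplication by \<open>H ^ n\<close>, degree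
  \<open>n - 1\<close> is a combination of the residues of \<open>g' / g ^ (n - i)\<close>. Only
  \<open>i = n - 1\<close> survives and gives \<open>n * w $ n\<close>.\<close>

lemma lagrange_inversion:
  fixes h w :: "'a::field_char_0 fps"
  assumes h: "h $ 0 \<noteq> 0" and w: "w oo (fps_X * h) = fps_X" and n: "n \<ge> 1"
  shows "of_nat n * w $ n = (inverse h ^ n) $ (n - 1)"
proof -
  define g where "g = fps_X * h"
  define H where "H = inverse h"
  have g0: "g $ 0 = 0" by (simp add: g_def)
  have hH: "h * H = 1" using h by (simp add: H_def inverse_mult_eq_1')
  have "(fps_deriv w oo g) * fps_deriv g = 1"
    using fps_compose_deriv[OF g0, of w] w by (simp add: g_def)
  then have "H ^ n = (fps_deriv w oo g) * (fps_deriv g * H ^ n)"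
    by (simp add: mult.assoc[symmetric])
  from trans[OF arg_cong[OF this, of "\<lambda>f. f $ (n - 1)"] fps_compose_mult_nth[OF g0]]
  have "(H ^ n) $ (n - 1) = (\<Sum>i\<le>n - 1. fps_deriv w $ i * (g ^ i * (fps_deriv g * H ^ n)) $ (n - 1))" .
  also have "\<dots> = (\<Sum>i\<le>n - 1. fps_deriv w $ i * (if i = n - 1 then 1 else 0))"
  proof (intro sum.cong refl arg_cong2[where f = "(*)"])
    fix i assume i: "i \<in> {..n - 1}"
    define m where "m = n - i"
    have nm: "n = m + i" "m \<ge> 1" using i n by (auto simp: m_def)
    have "g ^ i * (fps_deriv g * H ^ n) = fps_X ^ i * ((h + fps_X * fps_deriv h) * H ^ m) * (h * H) ^ i"
      by (simp add: g_def nm power_mult_distrib power_add algebra_simps)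
    then have "(g ^ i * (fps_deriv g * H ^ n)) $ (n - 1) = ((h + fps_X * fps_deriv h) * H ^ m) $ (m - 1)"
      using nm by (simp add: hH fps_X_power_mult_nth)
    then show "(g ^ i * (fps_deriv g * H ^ n)) $ (n - 1) = (if i = n - 1 then 1 else 0)"
      using residue_deriv_div_power[OF h nm(2)] nm by (auto simp: H_def)
  qed
  also have "\<dots> = of_nat n * w $ n"
    using n by (simp add: sum.delta mult_delta_right)
  finally show ?thesis by (simp add: H_def)
qed

section \<open>Coefficients of the compositional inverse of \<open>X + X ^ p\<close>\<close>

lemma fps_compose_X_power_nth:
  fixes f :: "'a::comm_ring_1 fps"
  assumes "k \<ge> 1"
  shows "(f oo fps_X ^ k) $ m = (if k dvd m then f $ (m div k) else 0)"
proof -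
  have e: "m = k * i \<longleftrightarrow> k dvd m \<and> i = m div k" for i
    using assms by auto
  have "(f oo fps_X ^ k) $ m = (\<Sum>i=0..m. if i = m div k then (if k dvd m then f $ i else 0) else 0)"
    unfolding fps_compose_nth
    by (intro sum.cong refl) (simp add: power_mult[symmetric] e)
  then show ?thesis by simp
qed

text \<open>Since \<open>X + X ^ p = X * (1 + X ^ (p - 1))\<close>, Lagrange inversion asks for a
  coefficient of the binomial series of exponent \<open>-j\<close> in
  \<open>X ^ (p - 1)\<close>.\<close>

lemma fps_inv_X_plus_X_power_nth:
  fixes p j :: nat
  defines "w \<equiv> fps_inv (fps_X + fps_X ^ p :: complex fps)"
  assumes p: "p \<ge> 2" and j: "j \<ge> 1"
  shows "w $ j = (if p - 1 dvd j - 1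
           then (-1) ^ ((j - 1) div (p - 1)) * catalan p ((j - 1) div (p - 1)) else 0)"
proof -
  define h :: "complex fps" where "h = 1 + fps_X ^ (p - 1)"
  have g: "fps_X + fps_X ^ p = fps_X * h"
    using p by (cases p) (auto simp: h_def algebra_simps)
  have h0: "h $ 0 \<noteq> 0" using p by (simp add: h_def)
  have "w oo (fps_X * h) = fps_X"
    unfolding w_def g using h0 by (intro fps_inv) auto
  then have L: "of_nat j * w $ j = (inverse h ^ j) $ (j - 1)"
    by (rule lagrange_inversion[OF h0 _ j])
  have X0: "(fps_X ^ (p - 1) :: complex fps) $ 0 = 0" using p by simp
  have "h = (1 + fps_X) oo fps_X ^ (p - 1)"
    using p by (simp add: h_def fps_compose_add_distrib)
  then have "inverse h = inverse (1 + fps_X) oo fps_X ^ (p - 1)"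
    using fps_inverse_compose[OF X0, of "1 + fps_X"] by simp
  then have "inverse h ^ j = inverse ((1 + fps_X) ^ j) oo fps_X ^ (p - 1)"
    by (metis fps_compose_power[OF X0] fps_inverse_power)
  also have "inverse ((1 + fps_X) ^ j) = fps_binomial (- of_nat j :: complex)"
    by (simp add: fps_binomial_minus_of_nat)
  finally have E: "(inverse h ^ j) $ (j - 1) = (if p - 1 dvd j - 1
        then (- of_nat j :: complex) gchoose ((j - 1) div (p - 1)) else 0)"
    using p by (simp add: fps_compose_X_power_nth)
  show ?thesis
  proof (cases "p - 1 dvd j - 1")
    case False
    then show ?thesis using L E j by simp
  next
    case True
    then obtain k where "j - 1 = (p - 1) * k" by (elim dvdE)
    then have k: "j = (p - 1) * k + 1" using j by simp
    have d: "(j - 1) div (p - 1) = k" using k p by simp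
    \<comment> \<open>Negating the upper index turns \<open>-j\<close> into
      \<open>j + k - 1 = p * k\<close>, as in the Catalan number. Its denominator
      \<open>(p - 1) * k + 1\<close> is \<open>j\<close> itself.\<close>
    have s: "of_nat j + of_nat k - 1 = (of_nat (p * k) :: complex)"
      using k p by (cases p) (auto simp: algebra_simps)
    have "(- of_nat j :: complex) gchoose k = (-1) ^ k * of_nat (p * k choose k)"
      by (simp only: gbinomial_minus s binomial_gbinomial)
    then have "of_nat j * w $ j = (-1) ^ k * of_nat (p * k choose k)"
      using L E True d by simp
    then have "w $ j = (-1) ^ k * of_nat (p * k choose k) / of_nat j"
      using j by (simp add: field_simps)
    then show ?thesis using True p by (simp add: d catalan_def k)
  qed
qed

subsection \<open>Isomorphisms of algebras\<close>

text \<open>Closure is what transport along an isomorphism uses; \<open>fps_alg n P Q\<close> has it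
  for all \<open>P\<close> and \<open>Q\<close>.\<close>

definition closed_alg :: "('k, 'v::ab_group_add) alg \<Rightarrow> bool" where
  "closed_alg L \<longleftrightarrow> 0 \<in> carrier L \<and>
     (\<forall>x\<in>carrier L. \<forall>y\<in>carrier L. x + y \<in> carrier L \<and> bracket L x y \<in> carrier L) \<and>
     (\<forall>c. \<forall>x\<in>carrier L. smul L c x \<in> carrier L)"

lemma closed_algD:
  assumes "closed_alg L"
  shows "0 \<in> carrier L"
    and "x \<in> carrier L \<Longrightarrow> y \<in> carrier L \<Longrightarrow> x + y \<in> carrier L"
    and "x \<in> carrier L \<Longrightarrow> y \<in> carrier L \<Longrightarrow> bracket L x y \<in> carrier L"
    and "x \<in> carrier L \<Longrightarrow> smul L c x \<in> carrier L"
  using assms by (auto simp: closed_alg_def)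

lemma linear_onD:
  assumes "linear_on L M f"
  shows "x \<in> carrier L \<Longrightarrow> f x \<in> carrier M"
    and "x \<in> carrier L \<Longrightarrow> y \<in> carrier L \<Longrightarrow> f (x + y) = f x + f y"
    and "x \<in> carrier L \<Longrightarrow> f (smul L c x) = smul M c (f x)"
  using assms by (auto simp: linear_on_def)

lemma linear_on_zero:
  fixes f :: "'v::ab_group_add \<Rightarrow> 'w::ab_group_add"
  assumes "linear_on L M f" "0 \<in> carrier L"
  shows "f 0 = 0"
  using linear_onD(2)[OF assms(1) assms(2) assms(2)] by simp

lemma leibniz_algebra_closed:
  assumes "leibniz_algebra L"
  shows "closed_alg L"
proof -
  interpret vector_space "smul L" using assms by (simp add: leibniz_algebra_def)
  have "subspace (carrier L)" using assms by (simp add: leibniz_algebra_def)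
  then show ?thesis
    using assms by (auto simp: leibniz_algebra_def closed_alg_def subspace_def linear_on_def image_subset_iff)
qed

lemma isomorphic_sym:
  assumes L: "closed_alg L" and "isomorphic L M"
  shows "isomorphic M L"
proof -
  obtain f where lin: "linear_on L M f" and bij: "bij_betw f (carrier L) (carrier M)"
    and br: "\<And>x y. x \<in> carrier L \<Longrightarrow> y \<in> carrier L \<Longrightarrow> f (bracket L x y) = bracket M (f x) (f y)"
    using assms(2) by (auto simp: isomorphic_def)
  define g where "g = inv_into (carrier L) f"
  have g: "bij_betw g (carrier M) (carrier L)"
    unfolding g_def by (rule bij_betw_inv_into[OF bij])
  have gf: "g (f x) = x" if "x \<in> carrier L" for x
    unfolding g_def using bij that by (simp add: bij_betw_def)
  have surj: "\<exists>x\<in>carrier L. y = f x" if "y \<in> carrier M" for y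
    using bij that by (auto simp: bij_betw_def)
  \<comment> \<open>Sums, products and multiples of preimages stay in the carrier of
    \<open>L\<close>, where \<open>g\<close> inverts \<open>f\<close>.\<close>
  note gfc = gf[OF closed_algD(2)[OF L]] gf[OF closed_algD(3)[OF L]] gf[OF closed_algD(4)[OF L]]
  have "linear_on M L g"
    unfolding linear_on_def
  proof (intro conjI ballI allI)
    show "g ` carrier M \<subseteq> carrier L" using g by (simp add: bij_betw_def)
  next
    fix x y assume "x \<in> carrier M" "y \<in> carrier M"
    then show "g (x + y) = g x + g y"
      using surj gf gfc(1) linear_onD(2)[OF lin] by metis
  next
    fix c x assume "x \<in> carrier M"
    then show "g (smul M c x) = smul L c (g x)"
      using surj gf gfc(3) linear_onD(3)[OF lin] by metis
  qed
  moreover have "g (bracket M x y) = bracket L (g x) (g y)" if "x \<in> carrier M" "y \<in> carrier M" for x y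
    using surj[OF that(1)] surj[OF that(2)] gf gfc(2) br by metis
  ultimately show ?thesis
    using g unfolding isomorphic_def by blast
qed

lemma isomorphic_trans:
  assumes "isomorphic L M" "isomorphic M N"
  shows "isomorphic L N"
proof -
  obtain f g where f: "linear_on L M f" "bij_betw f (carrier L) (carrier M)"
      "\<forall>x\<in>carrier L. \<forall>y\<in>carrier L. f (bracket L x y) = bracket M (f x) (f y)"
    and g: "linear_on M N g" "bij_betw g (carrier M) (carrier N)"
      "\<forall>x\<in>carrier M. \<forall>y\<in>carrier M. g (bracket M x y) = bracket N (g x) (g y)"
    using assms by (auto simp: isomorphic_def)
  have "linear_on L N (g \<circ> f)"
    using f(1) g(1) by (auto simp: linear_on_def image_subset_iff)
  moreover have "bij_betw (g \<circ> f) (carrier L) (carrier N)"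
    using f(2) g(2) by (rule bij_betw_trans)
  moreover have "(g \<circ> f) (bracket L x y) = bracket N ((g \<circ> f) x) ((g \<circ> f) y)"
    if "x \<in> carrier L" "y \<in> carrier L" for x y
    using f(3) g(3) that linear_onD(1)[OF f(1)] by simp
  ultimately show ?thesis
    unfolding isomorphic_def by blast
qed

text \<open>The derivation is conjugated by the isomorphism. Conjugation commutes with iteration, so
  a vanishing power of \<open>d'\<close> would give a vanishing power of \<open>d\<close>.\<close>

lemma derivation_transfer:
  assumes L: "closed_alg L" and "isomorphic L M"
    and d: "derivation L d" and nn: "\<not> nilpotent_map L d"
  shows "\<exists>d'. derivation M d' \<and> \<not> nilpotent_map M d'"
proof -
  obtain f where lin: "linear_on L M f" and bij: "bij_betw f (carrier L) (carrier M)"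
    and br: "\<And>x y. x \<in> carrier L \<Longrightarrow> y \<in> carrier L \<Longrightarrow> f (bracket L x y) = bracket M (f x) (f y)"
    using assms(2) by (auto simp: isomorphic_def)
  define g where "g = inv_into (carrier L) f"
  have gf: "g (f x) = x" if "x \<in> carrier L" for x
    unfolding g_def using bij that by (simp add: bij_betw_def)
  have surj: "\<exists>x\<in>carrier L. y = f x" if "y \<in> carrier M" for y
    using bij that by (auto simp: bij_betw_def)
  have dlin: "linear_on L L d" using d by (simp add: derivation_def)
  have dbr: "d (bracket L x y) = bracket L (d x) y + bracket L x (d y)"
    if "x \<in> carrier L" "y \<in> carrier L" for x y
    using d that by (simp add: derivation_def)
  define d' where "d' = (\<lambda>y. f (d (g y)))"
  have d'f: "d' (f x) = f (d x)" if "x \<in> carrier L" for x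
    using gf that by (simp add: d'_def)
  note cl = closed_algD[OF L] linear_onD(1)[OF dlin]
  have "linear_on M M d'"
    unfolding linear_on_def
  proof (intro conjI ballI allI)
    show "d' ` carrier M \<subseteq> carrier M"
      using surj d'f linear_onD(1)[OF lin] cl(5) by (metis image_subsetI)
  next
    fix x y assume "x \<in> carrier M" "y \<in> carrier M"
    then obtain a b where ab: "x = f a" "y = f b" "a \<in> carrier L" "b \<in> carrier L"
      using surj by metis
    have "x + y = f (a + b)" using ab linear_onD(2)[OF lin] by simp
    then have "d' (x + y) = f (d (a + b))" using ab cl d'f by simp
    then show "d' (x + y) = d' x + d' y"
      using ab d'f cl linear_onD(2)[OF lin] linear_onD(2)[OF dlin] by simp
  next
    fix c x assume "x \<in> carrier M"
    then obtain a where ab: "x = f a" "a \<in> carrier L" using surj by metis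
    have "smul M c x = f (smul L c a)" using ab linear_onD(3)[OF lin] by simp
    then have "d' (smul M c x) = f (d (smul L c a))" using ab cl d'f by simp
    then show "d' (smul M c x) = smul M c (d' x)"
      using ab d'f cl linear_onD(3)[OF lin] linear_onD(3)[OF dlin] by simp
  qed
  moreover have "d' (bracket M x y) = bracket M (d' x) y + bracket M x (d' y)"
    if "x \<in> carrier M" "y \<in> carrier M" for x y
  proof -
    obtain a b where ab: "x = f a" "y = f b" "a \<in> carrier L" "b \<in> carrier L"
      using surj \<open>x \<in> carrier M\<close> \<open>y \<in> carrier M\<close> by metis
    have "bracket M x y = f (bracket L a b)" using ab br by simp
    then have "d' (bracket M x y) = f (d (bracket L a b))" using ab cl d'f by simp
    then show ?thesis
      using ab d'f cl br dbr linear_onD(2)[OF lin] by simp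
  qed
  ultimately have "derivation M d'" by (simp add: derivation_def)
  moreover have "\<not> nilpotent_map M d'"
  proof
    assume "nilpotent_map M d'"
    then obtain m where m: "\<And>y. y \<in> carrier M \<Longrightarrow> (d' ^^ m) y = 0"
      by (auto simp: nilpotent_map_def)
    have it: "(d ^^ k) x \<in> carrier L \<and> (d' ^^ k) (f x) = f ((d ^^ k) x)" if "x \<in> carrier L" for x k
      by (induction k) (use that d'f cl in auto)
    have "(d ^^ m) x = 0" if x: "x \<in> carrier L" for x
    proof -
      have "f ((d ^^ m) x) = f 0"
        using m[OF linear_onD(1)[OF lin x]] it[OF x, of m] linear_on_zero[OF lin cl(1)] by simp
      then show ?thesis
        using bij it[OF x, of m] cl(1) by (auto simp: bij_betw_def inj_on_def)
    qed
    then show False using nn by (auto simp: nilpotent_map_def)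
  qed
  ultimately show ?thesis by blast
qed

subsection \<open>Algebras given by a pair of power series\<close>

lemma fps_cutoff_idem [simp]: "fps_cutoff n (fps_cutoff n f) = fps_cutoff n f"
  by (simp add: fps_eq_iff)

lemma fps_cutoff_mult_left: "fps_cutoff n (fps_cutoff n f * g) = fps_cutoff n (f * g)"
  by (simp add: fps_cutoff_eq_fps_cutoff_iff fps_cutoff_left_mult_nth)

lemma fps_cutoff_mult_right: "fps_cutoff n (f * fps_cutoff n g) = fps_cutoff n (f * g)"
  by (simp add: fps_cutoff_eq_fps_cutoff_iff fps_cutoff_right_mult_nth)

lemma fps_cutoff_const_mult: "fps_cutoff n (fps_const c * f) = fps_const c * fps_cutoff n f"
  for f :: "'a::comm_ring_1 fps"
  by (simp add: fps_eq_iff)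

text \<open>Substituting a series without constant term maps multiples of \<open>X ^ n\<close> to
  multiples of \<open>X ^ n\<close>.\<close>

lemma fps_cutoff_compose:
  fixes f g :: "'a::idom fps"
  assumes "g $ 0 = 0"
  shows "fps_cutoff n (fps_cutoff n f oo g) = fps_cutoff n (f oo g)"
  by (auto simp: fps_cutoff_eq_fps_cutoff_iff fps_compose_nth intro!: sum.cong)

text \<open>
  A pair \<open>(c, p)\<close> stands for \<open>c f\<^sub>0 + p\<close> with \<open>p\<close> in \<open>\<complex>[X] / X\<^sup>n\<close>. Left multiplication
  by \<open>f\<^sub>0\<close> vanishes; right multiplication by \<open>f\<^sub>0\<close> and by \<open>1\<close> multiplies \<open>p\<close> by \<open>P\<close> and \<open>Q\<close>.
\<close>

definition fps_alg ::
  "nat \<Rightarrow> complex fps \<Rightarrow> complex fps \<Rightarrow> (complex, complex \<times> complex fps) alg" where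
  "fps_alg n P Q =
     \<lparr>carrier = {v. fps_cutoff n (snd v) = snd v},
      smul = (\<lambda>c v. (c * fst v, fps_const c * snd v)),
      bracket = (\<lambda>x y. (0, fps_cutoff n (snd x *
        (fps_const (fst y) * P + fps_const (snd y $ 0) * Q))))\<rparr>"

lemma fps_alg_simps [simp]:
  "v \<in> carrier (fps_alg n P Q) \<longleftrightarrow> fps_cutoff n (snd v) = snd v"
  "smul (fps_alg n P Q) c v = (c * fst v, fps_const c * snd v)"
  "bracket (fps_alg n P Q) x y = (0, fps_cutoff n (snd x *
        (fps_const (fst y) * P + fps_const (snd y $ 0) * Q)))"
  by (simp_all add: fps_alg_def)

lemma closed_fps_alg: "closed_alg (fps_alg n P Q)"
  by (simp add: closed_alg_def fps_cutoff_add fps_cutoff_const_mult)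

lemma fps_alg_cong:
  assumes "fps_cutoff n Q = fps_cutoff n Q'"
  shows "fps_alg n P Q = fps_alg n P Q'"
proof -
  have "fps_cutoff n (p * (R + fps_const c * Q)) = fps_cutoff n (p * (R + fps_const c * Q'))" for p R c
    using assms by (metis fps_cutoff_add fps_cutoff_mult_right)
  then show ?thesis by (simp add: fps_alg_def)
qed

text \<open>Substituting \<open>g\<close> is an automorphism of the polynomials modulo
  \<open>X ^ n\<close>, with inverse the substitution of \<open>fps_inv g\<close>. It keeps the
  constant term \<open>snd y $ 0\<close>, so only \<open>P\<close> and \<open>Q\<close>
  change.\<close>

lemma fps_alg_change_variable:
  assumes n: "n > 0" and g0: "g $ 0 = 0" and g1: "g $ 1 \<noteq> 0"
  shows "isomorphic (fps_alg n P Q) (fps_alg n (P oo g) (Q oo g))"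
proof -
  define h where "h = fps_inv g"
  have h0: "h $ 0 = 0" by (simp add: h_def fps_inv_def)
  have gh: "(p oo g) oo h = p" "(p oo h) oo g = p" for p
    using fps_compose_assoc[OF h0 g0, of p] fps_compose_assoc[OF g0 h0, of p]
      fps_inv[OF g0 g1] fps_inv_right[OF g0 g1] by (simp_all add: h_def)
  define f where "f = (\<lambda>v :: complex \<times> complex fps. (fst v, fps_cutoff n (snd v oo g)))"
  define f' where "f' = (\<lambda>v :: complex \<times> complex fps. (fst v, fps_cutoff n (snd v oo h)))"
  have "bij_betw f (carrier (fps_alg n P Q)) (carrier (fps_alg n (P oo g) (Q oo g)))"
    by (rule bij_betw_byWitness[where f' = f'])
      (auto simp: f_def f'_def fps_cutoff_compose g0 h0 gh)
  moreover have "linear_on (fps_alg n P Q) (fps_alg n (P oo g) (Q oo g)) f"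
    by (auto simp: linear_on_def f_def fps_compose_add_distrib fps_cutoff_add
      fps_cutoff_const_mult fps_compose_mult_distrib[OF g0])
  moreover have "f (bracket (fps_alg n P Q) x y) = bracket (fps_alg n (P oo g) (Q oo g)) (f x) (f y)" for x y
    using n by (simp add: f_def fps_cutoff_compose g0 fps_compose_mult_distrib[OF g0]
      fps_compose_add_distrib fps_cutoff_mult_left)
  ultimately show ?thesis unfolding isomorphic_def by blast
qed

text \<open>Multiplying the second component by \<open>b\<close> also multiplies
  \<open>snd y $ 0\<close> by \<open>b\<close>, which absorbs the factor in front of
  \<open>Q\<close>.\<close>

lemma fps_alg_scale:
  assumes b: "b \<noteq> 0"
  shows "isomorphic (fps_alg n P (fps_const b * Q)) (fps_alg n P Q)"
proof -
  define f where "f = (\<lambda>v :: complex \<times> complex fps. (fst v, fps_const b * snd v))"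
  define f' where "f' = (\<lambda>v :: complex \<times> complex fps. (fst v, fps_const (1 / b) * snd v))"
  have "fps_const b * (fps_const (1 / b) * p) = p" "fps_const (1 / b) * (fps_const b * p) = p" for p
    using b by (simp_all flip: mult.assoc)
  then have "bij_betw f (carrier (fps_alg n P (fps_const b * Q))) (carrier (fps_alg n P Q))"
    by (intro bij_betw_byWitness[where f' = f'])
      (auto simp: f_def f'_def fps_cutoff_const_mult)
  moreover have "linear_on (fps_alg n P (fps_const b * Q)) (fps_alg n P Q) f"
    by (auto simp: linear_on_def f_def fps_cutoff_const_mult distrib_left mult.left_commute)
  moreover have "f (bracket (fps_alg n P (fps_const b * Q)) x y) = bracket (fps_alg n P Q) (f x) (f y)" for x y
  proof -
    have "fps_const b * (snd x * (fps_const (fst y) * P + fps_const (snd y $ 0) * (fps_const b * Q)))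
        = fps_const b * snd x * (fps_const (fst y) * P + fps_const (b * snd y $ 0) * Q)"
      unfolding fps_const_mult[symmetric] by (simp only: algebra_simps)
    then show ?thesis
      by (simp only: fps_alg_simps f_def fst_conv snd_conv fps_mult_left_const_nth
        flip: fps_cutoff_const_mult)
  qed
  ultimately show ?thesis unfolding isomorphic_def by blast
qed

text \<open>Multiplying by \<open>(1, 0)\<close> shifts \<open>snd z\<close> up by one degree, so
  only its coefficient in degree \<open>n - 1\<close> can survive.\<close>

lemma fps_alg_left_annihilator:
  assumes z: "z \<in> carrier (fps_alg n fps_X Q)"
    and ann: "\<And>y. y \<in> carrier (fps_alg n fps_X Q) \<Longrightarrow> bracket (fps_alg n fps_X Q) z y = 0"
    and i: "i + 1 < n"
  shows "snd z $ i = 0"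
proof -
  have "fps_cutoff n (snd z * fps_X) = 0"
    using ann[of "(1, 0)"] by (simp add: zero_prod_def)
  then have "fps_cutoff n (snd z * fps_X) $ (i + 1) = 0" by simp
  then show ?thesis using i by simp
qed

text \<open>
  The terms are the multiples of \<open>(1, 0)\<close> and \<open>(0, 1)\<close> and a product with \<open>(1, 0)\<close> in
  \<^term>\<open>fps_alg n fps_X Q\<close>, already unfolded.
\<close>

lemma pair_fps_decompose:
  fixes p :: "complex fps"
  shows "(c, p) = (c * 1, fps_const c * 0) + (p $ 0 * 0, fps_const (p $ 0) * 1) + (0, fps_shift 1 p * fps_X)"
proof -
  have "p = fps_const (p $ 0) + fps_shift 1 p * fps_X"
    by (rule fps_ext) (simp add: fps_X_mult_right_nth)
  then show ?thesis by simp
qed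

text \<open>An isomorphism sends \<open>(1, 0)\<close> to a left annihilating element, hence right
  multiplication by \<open>X\<close> to right multiplication by \<open>a * X\<close>. Comparing the
  two values of \<open>f\<close> on \<open>[1, 1] = X ^ i\<close> then forces the exponents to
  agree.\<close>

lemma fps_alg_X_power_not_isomorphic:
  assumes i: "2 \<le> i" "i < n" and j: "2 \<le> j" "j < n" and ij: "i \<noteq> j"
  shows "\<not> isomorphic (fps_alg n fps_X (fps_X ^ i)) (fps_alg n fps_X (fps_X ^ j))"
    (is "\<not> isomorphic ?L ?M")
proof
  assume "isomorphic ?L ?M"
  then obtain f where lin: "linear_on ?L ?M f" and bij: "bij_betw f (carrier ?L) (carrier ?M)"
    and br: "\<And>x y. x \<in> carrier ?L \<Longrightarrow> y \<in> carrier ?L \<Longrightarrow> f (bracket ?L x y) = bracket ?M (f x) (f y)"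
    unfolding isomorphic_def by blast
  note lin = linear_onD[OF lin] linear_on_zero[OF lin closed_algD(1)[OF closed_fps_alg]]
  define z where "z = f (1, 0)"
  define a where "a = fst z"
  define r where "r = fst (f (0, 1))"
  define q where "q = snd (f (0, 1))"
  have n: "n \<ge> 2" using i by simp
  have c0: "(1, 0) \<in> carrier ?L" and c1: "(0, 1) \<in> carrier ?L"
    using n by (simp_all add: fps_cutoff_one)
  have zc: "z \<in> carrier ?M" unfolding z_def by (rule lin(1)[OF c0])
  have qc: "fps_cutoff n q = q" using lin(1)[OF c1] by (simp add: q_def)
  have "bracket ?M z y = 0" if y: "y \<in> carrier ?M" for y
  proof -
    obtain x where x: "x \<in> carrier ?L" "y = f x"
      using bij_betw_imp_surj_on[OF bij] y by (metis imageE)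
    have "bracket ?M z y = f (bracket ?L (1, 0) x)"
      unfolding z_def x(2) by (rule br[OF c0 x(1), symmetric])
    moreover have e: "bracket ?L (1, 0) x = 0" by (simp add: zero_prod_def)
    ultimately show ?thesis by (simp only: e lin(4))
  qed
  then have z0: "snd z $ 0 = 0"
    using fps_alg_left_annihilator[OF zc, of 0] n by simp
  \<comment> \<open>The product with \<open>(1, 0)\<close> on the right does not see
    \<open>c\<close>, and \<open>z\<close> acts as \<open>a * X\<close> because \<open>snd z\<close>
    has no constant term.\<close>
  have fX: "f (0, fps_cutoff n (p * fps_X)) = (0, fps_cutoff n (snd (f (c, p)) * (fps_const a * fps_X)))"
    if "fps_cutoff n p = p" for c p
  proof -
    have "(c, p) \<in> carrier ?L" using that by simp
    from br[OF this c0] show ?thesis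
      by (simp flip: z_def add: z0 a_def)
  qed
  have fXk: "snd (f (0, fps_cutoff n (fps_X ^ k))) = fps_cutoff n (fps_const (a ^ k) * fps_X ^ k * q)" for k
  proof (induction k)
    case 0
    then show ?case using n qc by (simp add: fps_cutoff_one q_def)
  next
    case (Suc k)
    have "fps_cutoff n (fps_X ^ Suc k) = fps_cutoff n (fps_cutoff n (fps_X ^ k) * fps_X :: complex fps)"
      by (simp only: fps_cutoff_mult_left power_Suc2)
    then have "snd (f (0, fps_cutoff n (fps_X ^ Suc k)))
        = fps_cutoff n (snd (f (0, fps_cutoff n (fps_X ^ k))) * (fps_const a * fps_X))"
      using fX[of "fps_cutoff n (fps_X ^ k)" 0] by simp
    also have "\<dots> = fps_cutoff n (fps_const (a ^ k) * fps_X ^ k * q * (fps_const a * fps_X))"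
      by (simp only: Suc fps_cutoff_mult_left)
    also have "fps_const (a ^ k) * fps_X ^ k * q * (fps_const a * fps_X)
        = fps_const (a ^ Suc k) * fps_X ^ Suc k * q"
      by (simp add: mult_ac flip: fps_const_mult)
    finally show ?case .
  qed
  \<comment> \<open>Surjectivity yields \<open>q $ 0 \<noteq> 0\<close>: in the image of any
    \<open>v\<close>, the multiple of \<open>z\<close> and the product with \<open>X\<close> have no
    constant term.\<close>
  have "(0, 1) \<in> carrier ?M" using n by (simp add: fps_cutoff_one)
  then obtain v where v: "v \<in> carrier ?L" "f v = (0, 1)"
    using bij_betw_imp_surj_on[OF bij] by (metis imageE)
  obtain c p where cp: "v = (c, p)" by (cases v)
  define p' where "p' = fps_shift 1 p"
  have pc: "fps_cutoff n p = p" using v cp by simp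
  have p0: "p $ k = 0" if "k \<ge> n" for k
    using arg_cong[OF pc, of "\<lambda>f. f $ k"] that by simp
  have p'c: "fps_cutoff n p' = p'" "fps_cutoff n (p' * fps_X) = p' * fps_X"
    by (auto simp: p'_def fps_eq_iff p0 fps_X_mult_right_nth)
  have "v = smul ?L c (1, 0) + smul ?L (p $ 0) (0, 1) + (0, fps_cutoff n (p' * fps_X))"
    unfolding fps_alg_simps fst_conv snd_conv cp p'c(2) unfolding p'_def by (rule pair_fps_decompose)
  also have "f \<dots> = smul ?M c z + smul ?M (p $ 0) (f (0, 1)) + (0, fps_cutoff n (snd (f (0, p')) * (fps_const a * fps_X)))"
  proof -
    have m3: "(0, fps_cutoff n (p' * fps_X)) \<in> carrier ?L" by simp
    note m = closed_algD(4)[OF closed_fps_alg c0, of c]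
      closed_algD(4)[OF closed_fps_alg c1, of "p $ 0"] m3
    show ?thesis
      unfolding lin(2)[OF closed_algD(2)[OF closed_fps_alg m(1,2)] m(3)] lin(2)[OF m(1,2)]
        lin(3)[OF c0] lin(3)[OF c1] fX[OF p'c(1), of 0] z_def ..
  qed
  finally have "snd (f v) $ 0 = p $ 0 * q $ 0"
    using n by (simp add: z0 q_def)
  then have q0: "q $ 0 \<noteq> 0" using v by auto
  have "fps_cutoff n (fps_const (a ^ i) * fps_X ^ i * q)
      = fps_cutoff n (q * (fps_const r * fps_X + fps_const (q $ 0) * fps_X ^ j))"
    using fXk[of i] br[OF c1 c1] by (simp add: q_def r_def)
  then have E: "(fps_const (a ^ i) * (fps_X ^ i * q)) $ k
      = (fps_const r * (fps_X * q) + fps_const (q $ 0) * (fps_X ^ j * q)) $ k" if "k < n" for k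
    unfolding fps_cutoff_eq_fps_cutoff_iff using that by (simp add: algebra_simps)
  have X: "a ^ i * (if k < i then 0 else q $ (k - i)) =
      r * (if k = 0 then 0 else q $ (k - 1)) + q $ 0 * (if k < j then 0 else q $ (k - j))" if "k < n" for k
    using E[OF that] by (simp add: fps_X_power_mult_nth)
  \<comment> \<open>Both \<open>i\<close> and \<open>j\<close> are at least 2, so degree 1 only
    contains \<open>r * q $ 0\<close>.\<close>
  have r: "r = 0" using X[of 1] i j q0 by simp
  show False
  \<comment> \<open>The right side has order exactly \<open>j\<close>. The left side has order at
    least \<open>i\<close>, with coefficient \<open>a ^ i * q $ 0\<close> in degree
    \<open>i\<close>.\<close>
  proof (cases "i < j")
    case True
    have "a ^ i = 0" using X[of i] True i r q0 by simp
    then show False using X[of j] i j r q0 by (simp add: power_0_left)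
  next
    case False
    then show False using X[of j] j r q0 ij by simp
  qed
qed

text \<open>On second components \<open>d\<close> is multiplication by \<open>q\<close> plus
  \<open>a\<close> times the Euler operator \<open>X * p'\<close>, up to truncation. If
  \<open>a \<noteq> 0\<close>, the relation from \<open>[1, 1] = B\<close> allows one degree in
  \<open>B\<close>; if \<open>a = 0\<close>, then \<open>q\<close> has no constant term and
  \<open>d\<close> is nilpotent.\<close>

lemma fps_alg_derivation_nilpotent_or_monomial:
  assumes n: "n \<ge> 2" and B0: "B $ 0 = 0" and B1: "B $ 1 = 0"
    and der: "derivation (fps_alg n fps_X B) d" and nn: "\<not> nilpotent_map (fps_alg n fps_X B) d"
    and i: "i < n" "B $ i \<noteq> 0"
  shows "fps_cutoff n B = fps_cutoff n (fps_const (B $ i) * fps_X ^ i)"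
proof -
  let ?L = "fps_alg n fps_X B"
  have dlin: "linear_on ?L ?L d" and
    br: "\<And>x y. x \<in> carrier ?L \<Longrightarrow> y \<in> carrier ?L \<Longrightarrow>
      d (bracket ?L x y) = bracket ?L (d x) y + bracket ?L x (d y)"
    using der by (auto simp only: derivation_def)
  note lin = linear_onD[OF dlin] linear_on_zero[OF dlin closed_algD(1)[OF closed_fps_alg]]
  define z where "z = d (1, 0)"
  define a where "a = fst z"
  define r where "r = fst (d (0, 1))"
  define q where "q = snd (d (0, 1))"
  have c0: "(1, 0) \<in> carrier ?L" and c1: "(0, 1) \<in> carrier ?L"
    using n by (simp_all add: fps_cutoff_one)
  have zc: "z \<in> carrier ?L" unfolding z_def by (rule lin(1)[OF c0])
  have qc: "fps_cutoff n q = q" using lin(1)[OF c1] by (simp add: q_def)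
  have zann: "bracket ?L z y = 0" if y: "y \<in> carrier ?L" for y
  proof -
    have e: "bracket ?L (1, 0) v = 0" for v by (simp add: zero_prod_def)
    show ?thesis using br[OF c0 y] by (simp only: e lin(4) add_0_right z_def)
  qed
  have z0: "snd z $ k = 0" if "k + 1 < n" for k
    using fps_alg_left_annihilator[OF zc zann that] .
  have dX: "d (0, fps_cutoff n (p * fps_X)) =
      (0, fps_cutoff n (snd (d (c, p)) * fps_X + p * (fps_const a * fps_X)))"
    if "fps_cutoff n p = p" for c p
  proof -
    have "(c, p) \<in> carrier ?L" using that by simp
    from br[OF this c0] show ?thesis
      using n by (simp flip: z_def add: z0 a_def fps_cutoff_add)
  qed
  \<comment> \<open>Writing \<open>p\<close> as its constant term plus \<open>X\<close> times its
    shift reduces \<open>d\<close> to its values on the two generators and on a shorter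
    series.\<close>
  have decomp: "d (c, p) = smul ?L c z + smul ?L (p $ 0) (r, q) +
      (0, fps_cutoff n (snd (d (0, fps_shift 1 p)) * fps_X + fps_shift 1 p * (fps_const a * fps_X)))"
    if p: "fps_cutoff n p = p" for c p
  proof -
    have pk: "p $ k = 0" if "k \<ge> n" for k
      using arg_cong[OF p, of "\<lambda>f. f $ k"] that by simp
    define p' where "p' = fps_shift 1 p"
    have p'c: "fps_cutoff n p' = p'" "fps_cutoff n (p' * fps_X) = p' * fps_X"
      by (auto simp: p'_def fps_eq_iff pk fps_X_mult_right_nth)
    have "(c, p) = smul ?L c (1, 0) + smul ?L (p $ 0) (0, 1) + (0, fps_cutoff n (p' * fps_X))"
      unfolding fps_alg_simps fst_conv snd_conv p'c(2) unfolding p'_def by (rule pair_fps_decompose)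
    then have dcp: "d (c, p) = d (smul ?L c (1, 0) + smul ?L (p $ 0) (0, 1) + (0, fps_cutoff n (p' * fps_X)))"
      by (rule arg_cong)
    have m3: "(0, fps_cutoff n (p' * fps_X)) \<in> carrier ?L" by simp
    note m = closed_algD(4)[OF closed_fps_alg c0, of c]
      closed_algD(4)[OF closed_fps_alg c1, of "p $ 0"] m3
    have rq: "d (0, 1) = (r, q)" by (simp add: r_def q_def)
    show ?thesis
      unfolding dcp lin(2)[OF closed_algD(2)[OF closed_fps_alg m(1,2)] m(3)] lin(2)[OF m(1,2)]
        lin(3)[OF c0] lin(3)[OF c1] dX[OF p'c(1), of 0] rq
      unfolding z_def p'_def ..
  qed
  have dp: "snd (d (0, p)) = fps_cutoff n (p * q + fps_const a * (fps_X * fps_deriv p))"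
    if "\<And>j. j \<ge> k \<Longrightarrow> p $ j = 0" "k \<le> n" for k p
    using that
  proof (induction k arbitrary: p)
    case 0
    then have "p = 0" by (simp add: fps_eq_iff)
    then show ?case using lin(4) by (simp add: zero_prod_def)
  next
    case (Suc k)
    define p' where "p' = fps_shift 1 p"
    have p: "p = fps_const (p $ 0) + p' * fps_X"
      by (rule fps_ext) (simp add: fps_X_mult_right_nth p'_def)
    have pc: "fps_cutoff n p = p" using Suc.prems by (auto simp: fps_eq_iff)
    define F where "F = p' * q + fps_const a * (fps_X * fps_deriv p')"
    have IH: "snd (d (0, p')) = fps_cutoff n F"
      unfolding F_def using Suc.prems by (intro Suc.IH) (auto simp: p'_def)
    have "snd (d (0, p)) = fps_const (p $ 0) * q +
        fps_cutoff n (snd (d (0, p')) * fps_X + p' * (fps_const a * fps_X))"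
      using decomp[OF pc, of 0] by (simp add: p'_def)
    also have "\<dots> = fps_cutoff n (fps_const (p $ 0) * q +
        (F * fps_X + p' * (fps_const a * fps_X)))"
      by (simp only: IH fps_cutoff_add fps_cutoff_mult_left fps_cutoff_const_mult qc)
    also have "fps_const (p $ 0) * q +
        (F * fps_X + p' * (fps_const a * fps_X))
      = p * q + fps_const a * (fps_X * fps_deriv p)"
    proof -
      have "fps_deriv p = fps_deriv p' * fps_X + p'" by (subst p) simp
      moreover have "p * q = fps_const (p $ 0) * q + p' * fps_X * q"
        by (subst p) (simp only: distrib_right)
      ultimately show ?thesis by (simp only: F_def algebra_simps)
    qed
    finally show ?case .
  qed
  \<comment> \<open>Applying \<open>d\<close> to \<open>[1, 1] = B\<close> in two ways, the products
    \<open>q * B\<close> cancel and the Euler operator leaves the factor \<open>k\<close>.\<close>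
  have key: "a * of_nat k * B $ k = (if k = 1 then r else 0) + q $ 0 * B $ k" if k: "k < n" for k
  proof -
    have "snd (d (0, fps_cutoff n B)) = fps_cutoff n (q * B) +
        fps_cutoff n (fps_const r * fps_X + fps_const (q $ 0) * B)"
      using br[OF c1 c1] by (simp add: r_def q_def)
    moreover have "snd (d (0, fps_cutoff n B)) = fps_cutoff n
        (fps_cutoff n B * q + fps_const a * (fps_X * fps_deriv (fps_cutoff n B)))"
      by (rule dp[of n]) auto
    moreover have "fps_cutoff n (fps_cutoff n B * q) = fps_cutoff n (q * B)"
      by (subst mult.commute[of q]) (rule fps_cutoff_mult_left)
    ultimately have "fps_cutoff n (fps_const a * (fps_X * fps_deriv (fps_cutoff n B)))
        = fps_cutoff n (fps_const r * fps_X + fps_const (q $ 0) * B)"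
      by (simp add: fps_cutoff_add)
    from arg_cong[OF this, of "\<lambda>f. f $ k"]
    have "a * (of_nat k * fps_cutoff n B $ k) = r * fps_X $ k + q $ 0 * B $ k"
      by (simp only: k fps_cutoff_nth fps_mult_left_const_nth fps_add_nth
        fps_X_mult_deriv_nth if_True)
    then show ?thesis using k by (simp add: mult.assoc)
  qed
  have r: "r = 0" using key[of 1] n B1 by simp
  have weight: "a * of_nat k = q $ 0" if "k < n" "B $ k \<noteq> 0" for k
    using key[OF that(1)] that(2) unfolding r if_cancel by simp
  have a: "a \<noteq> 0"
  proof
    assume a: "a = 0"
    then have q0: "q $ 0 = 0" using weight[OF i] by simp
    have d: "d (c, p) = (0, fps_const c * snd z + fps_cutoff n (p * q))"
      if p: "fps_cutoff n p = p" for c p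
    proof -
      have "p $ k = 0" if "k \<ge> n" for k
        using arg_cong[OF p, of "\<lambda>f. f $ k"] that by simp
      then have "snd (d (0, p)) = fps_cutoff n (p * q)"
        using dp[of n p] a by simp
      then show ?thesis using decomp[OF p, of c] decomp[OF p, of 0] a r by (simp add: a_def prod_eq_iff)
    qed
    \<comment> \<open>The first application removes the first component. Each later one multiplies
      by \<open>q\<close>, which has no constant term, and clears one more coefficient.\<close>
    have it: "(d ^^ Suc k) v \<in> carrier ?L \<and> fst ((d ^^ Suc k) v) = 0 \<and>
        (\<forall>j<k. snd ((d ^^ Suc k) v) $ j = 0)" if v: "v \<in> carrier ?L" for v k
    proof (induction k)
      case 0
      then show ?case using v lin(1)[OF v] d[of "snd v" "fst v"] by simp
    next
      case (Suc k)
      define w where "w = snd ((d ^^ Suc k) v)"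
      have w: "(d ^^ Suc k) v = (0, w)" using Suc by (simp add: w_def prod_eq_iff)
      have wc: "fps_cutoff n w = w" using Suc by (simp add: w_def)
      have "(w * q) $ j = 0" if "j < Suc k" for j
        unfolding fps_mult_nth
      proof (intro sum.neutral ballI)
        fix l assume "l \<in> {0..j}"
        then show "w $ l * q $ (j - l) = 0"
          using that Suc q0 by (cases "l = j") (auto simp: w_def)
      qed
      then have "\<forall>j<Suc k. snd ((d ^^ Suc (Suc k)) v) $ j = 0"
        using d[OF wc, of 0] w by simp
      moreover have "(d ^^ Suc (Suc k)) v = d (0, w)" using w by simp
      ultimately show ?case
        using d[OF wc, of 0] lin(1)[of "(0, w)"] wc by simp
    qed
    have "(d ^^ Suc n) v = 0" if v: "v \<in> carrier ?L" for v
    proof -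
      define w where "w = (d ^^ Suc n) v"
      have w: "fps_cutoff n (snd w) = snd w" "fst w = 0" "\<And>j. j < n \<Longrightarrow> snd w $ j = 0"
        using it[OF v, of n] by (auto simp: w_def simp del: funpow.simps)
      have "snd w $ j = 0" for j
        using w(3)[of j] arg_cong[OF w(1), of "\<lambda>f. f $ j"] by (cases "j < n") auto
      then have "snd w = 0" by (simp add: fps_eq_iff)
      then show ?thesis using w(2) by (simp add: w_def[symmetric] prod_eq_iff del: funpow.simps)
    qed
    then show False using nn unfolding nilpotent_map_def by blast
  qed
  have "B $ k = 0" if k: "k < n" "k \<noteq> i" for k
  proof (rule ccontr)
    assume "B $ k \<noteq> 0"
    then have "a * of_nat k = a * of_nat i"
      using weight[OF k(1)] weight[OF i] by simp
    then show False using a k(2) by simp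
  qed
  then show ?thesis by (auto simp: fps_eq_iff)
qed

subsection \<open>The family F1\<close>

lemma sum_apply_fun: "(\<Sum>i\<in>S. f i) m = (\<Sum>i\<in>S. f i m :: 'a::comm_monoid_add)"
  by (induction S rule: infinite_finite_induct) auto

lemma basis_vec_apply: "basis_vec i j = (if j = i then 1 else 0)"
  by (simp add: basis_vec_def)

lemma sum_scale_basis_vec_apply:
  assumes "finite S"
  shows "(\<Sum>k\<in>S. scale_fun (c k) (basis_vec k)) m = (if m \<in> S then c m else 0)"
proof -
  have "(\<Sum>k\<in>S. scale_fun (c k) (basis_vec k)) m = (\<Sum>k\<in>S. if k = m then c k else 0)"
    unfolding sum_apply_fun by (intro sum.cong) (auto simp: scale_fun_def basis_vec_def)
  then show ?thesis using assms by simp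
qed

text \<open>Parameters with index above \<open>n\<close> land in degrees from \<open>n\<close> on
  and vanish modulo \<open>X ^ n\<close>.\<close>

definition F1_series :: "(nat \<Rightarrow> complex) \<Rightarrow> complex fps" where
  "F1_series \<alpha> = Abs_fps (\<lambda>i. if i \<ge> 2 then \<alpha> (i + 1) else 0)"

lemma F1_series_nth [simp]: "F1_series \<alpha> $ i = (if i \<ge> 2 then \<alpha> (i + 1) else 0)"
  by (simp add: F1_series_def)

text \<open>Here \<open>\<theta> = \<alpha> n\<close> enters: the product of \<open>e_0\<close> and
  \<open>e_1\<close> becomes the same sum as that of \<open>e_1\<close> and \<open>e_1\<close>, so
  \<open>e_0 - e_1\<close> annihilates from the left.\<close>

lemma F1_table_01:
  assumes "n \<ge> 3"
  shows "F1_table n \<alpha> (\<alpha> n) 0 1 = (\<Sum>k = 3..n. scale_fun (\<alpha> k) (basis_vec k))"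
proof -
  have "{3..n} = insert n {3..n - 1}" using assms by auto
  moreover have "n \<notin> {3..n - 1}" using assms by auto
  ultimately show ?thesis by (simp add: F1_table_def add.commute)
qed

lemma F1_table_apply:
  assumes n: "n \<ge> 3" and l: "l < n"
  shows "F1_table n \<alpha> (\<alpha> n) 0 0 (Suc l) = (if l = 1 then 1 else 0)"
    and "F1_table n \<alpha> (\<alpha> n) (Suc k) 0 (Suc l) = (if Suc k = l then 1 else 0)"
    and "F1_table n \<alpha> (\<alpha> n) 0 (Suc 0) (Suc l) = F1_series \<alpha> $ l"
    and "F1_table n \<alpha> (\<alpha> n) (Suc k) (Suc 0) (Suc l) = (if k \<le> l then F1_series \<alpha> $ (l - k) else 0)"
proof -
  show "F1_table n \<alpha> (\<alpha> n) 0 0 (Suc l) = (if l = 1 then 1 else 0)"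
    by (auto simp: F1_table_def basis_vec_def)
  show "F1_table n \<alpha> (\<alpha> n) (Suc k) 0 (Suc l) = (if Suc k = l then 1 else 0)"
    using l by (auto simp: F1_table_def basis_vec_def)
  show "F1_table n \<alpha> (\<alpha> n) 0 (Suc 0) (Suc l) = F1_series \<alpha> $ l"
    using F1_table_01[OF n, of \<alpha>] l by (simp add: sum_scale_basis_vec_apply)
  show "F1_table n \<alpha> (\<alpha> n) (Suc k) (Suc 0) (Suc l) = (if k \<le> l then F1_series \<alpha> $ (l - k) else 0)"
    using l by (auto simp: F1_table_def sum_scale_basis_vec_apply Suc_diff_le)
qed

lemma F1_table_zero: "j \<ge> 2 \<Longrightarrow> F1_table n \<alpha> \<theta> i j = 0"
  by (auto simp: F1_table_def)

lemma F1_table_outside: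
  assumes "n \<ge> 3" "m = 0 \<or> m > n"
  shows "F1_table n \<alpha> (\<alpha> n) i j m = 0"
  using assms F1_table_01[OF assms(1), of \<alpha>]
  by (auto simp: F1_table_def sum_scale_basis_vec_apply basis_vec_apply)

lemma F1_bracket_apply:
  "bracket (F1 n \<alpha> \<theta>) x y m = (\<Sum>i\<le>n. \<Sum>j\<le>n. x i * y j * F1_table n \<alpha> \<theta> i j m)"
  by (simp add: F1_def sum_apply_fun scale_fun_def)

text \<open>The coordinates of \<open>v\<close> in the basis \<open>f\<^sub>0 = e\<^sub>0 - e\<^sub>1, e\<^sub>1, \<dots>, e\<^sub>n\<close>, with \<open>e\<^sub>i\<close> read as \<open>X\<^bsup>i-1\<^esup>\<close>.\<close>

definition F1_coords :: "nat \<Rightarrow> (nat \<Rightarrow> complex) \<Rightarrow> complex \<times> complex fps" where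
  "F1_coords n v = (v 0, Abs_fps (\<lambda>i. if i < n then (if i = 0 then v 0 else 0) + v (Suc i) else 0))"

lemma F1_coords_simps [simp]:
  "fst (F1_coords n v) = v 0"
  "snd (F1_coords n v) $ i = (if i < n then (if i = 0 then v 0 else 0) + v (Suc i) else 0)"
  by (simp_all add: F1_coords_def)

text \<open>Only right factors \<open>e_0\<close> and \<open>e_1\<close> act, by \<open>X\<close>
  and by \<open>F1_series \<alpha>\<close>. As left factors they agree, so \<open>x\<close> enters
  only through its series.\<close>

lemma F1_bracket_Suc:
  assumes n: "n \<ge> 3" and l: "l < n"
  shows "bracket (F1 n \<alpha> (\<alpha> n)) x y (Suc l) =
    (snd (F1_coords n x) * (fps_const (y 0) * fps_X + fps_const (y 1) * F1_series \<alpha>)) $ l"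
proof -
  let ?T = "\<lambda>i j. F1_table n \<alpha> (\<alpha> n) i j (Suc l)"
  let ?p = "snd (F1_coords n x)"
  obtain n' where n': "n = Suc n'" using n by (cases n) auto
  have inner: "(\<Sum>j\<le>n. x i * y j * ?T i j) = x i * y 0 * ?T i 0 + x i * y 1 * ?T i 1" for i
  proof -
    have "(\<Sum>j\<le>n. x i * y j * ?T i j) = (\<Sum>j\<in>{0, 1}. x i * y j * ?T i j)"
      using n by (intro sum.mono_neutral_right) (auto simp: F1_table_zero)
    then show ?thesis by simp
  qed
  have split: "(\<Sum>i\<le>n. f i) = f 0 + (\<Sum>k<n. f (Suc k))" for f :: "nat \<Rightarrow> complex"
    by (simp add: sum.atMost_shift)
  have "(\<Sum>i\<le>n. x i * ?T i 0) = (?p * fps_X) $ l"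
  proof -
    \<comment> \<open>The guard covers \<open>l = 0\<close>, where \<open>l - 1\<close> truncates to
      \<open>0\<close> although no \<open>k\<close> satisfies \<open>Suc k = l\<close>.\<close>
    have "(\<Sum>k<n. x (Suc k) * ?T (Suc k) 0) = (\<Sum>k<n. if k = l - 1 then (if l = 0 then 0 else x (Suc k)) else 0)"
      using n l by (intro sum.cong refl) (auto simp: F1_table_apply)
    also have "\<dots> = (if l = 0 then 0 else x l)" using l by simp
    finally show ?thesis
      using n l by (auto simp: split F1_table_apply fps_X_mult_right_nth)
  qed
  moreover have "(\<Sum>i\<le>n. x i * ?T i 1) = (?p * F1_series \<alpha>) $ l"
  proof -
    have "(\<Sum>k<n. x (Suc k) * ?T (Suc k) 1) = (\<Sum>k<n. x (Suc k) * (if k \<le> l then F1_series \<alpha> $ (l - k) else 0))"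
      using F1_table_apply(4)[OF n l] by (intro sum.cong refl) (simp only: One_nat_def)
    also have "\<dots> = (\<Sum>k\<le>l. x (Suc k) * F1_series \<alpha> $ (l - k))"
      using l by (intro sum.mono_neutral_cong_right) auto
    finally have "(\<Sum>i\<le>n. x i * ?T i 1) =
        x 0 * F1_series \<alpha> $ l + (\<Sum>k\<le>l. x (Suc k) * F1_series \<alpha> $ (l - k))"
      using F1_table_apply(3)[OF n l, of \<alpha>] unfolding split One_nat_def by (simp only:)
    \<comment> \<open>The coordinate of \<open>e_0\<close> is part of the constant term of
      \<open>?p\<close>, so it joins the summand \<open>k = 0\<close>.\<close>
    also have "x 0 * F1_series \<alpha> $ l = (\<Sum>k\<le>l. if k = 0 then x 0 * F1_series \<alpha> $ (l - k) else 0)"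
      by simp
    also have "\<dots> + (\<Sum>k\<le>l. x (Suc k) * F1_series \<alpha> $ (l - k)) = (\<Sum>k\<le>l. ?p $ k * F1_series \<alpha> $ (l - k))"
      unfolding sum.distrib[symmetric] using l by (intro sum.cong refl) (auto simp: algebra_simps)
    finally show ?thesis by (simp add: fps_mult_nth atLeast0AtMost)
  qed
  moreover have "bracket (F1 n \<alpha> (\<alpha> n)) x y (Suc l) =
      y 0 * (\<Sum>i\<le>n. x i * ?T i 0) + y 1 * (\<Sum>i\<le>n. x i * ?T i 1)"
    unfolding F1_bracket_apply inner by (simp add: sum.distrib sum_distrib_left mult_ac)
  moreover have "?p * (fps_const (y 0) * fps_X + fps_const (y 1) * F1_series \<alpha>) =
      fps_const (y 0) * (?p * fps_X) + fps_const (y 1) * (?p * F1_series \<alpha>)"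
    by (simp only: algebra_simps)
  ultimately show ?thesis by (simp only: fps_add_nth fps_mult_left_const_nth)
qed

lemma F1_bracket_outside:
  assumes "n \<ge> 3" "m = 0 \<or> m > n"
  shows "bracket (F1 n \<alpha> (\<alpha> n)) x y m = 0"
  unfolding F1_bracket_apply by (simp add: F1_table_outside[OF assms])

lemma closed_F1:
  assumes "n \<ge> 3"
  shows "closed_alg (F1 n \<alpha> (\<alpha> n))"
proof -
  have "bracket (F1 n \<alpha> (\<alpha> n)) x y \<in> carrier (F1 n \<alpha> (\<alpha> n))" for x y
    using F1_bracket_outside[OF assms, of _ \<alpha> x y] by (simp add: F1_def)
  then show ?thesis
    by (auto simp: closed_alg_def) (auto simp: F1_def scale_fun_def)
qed

text \<open>With \<open>A = F1_series \<alpha>\<close>, the coordinates of \<open>y\<close> at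
  \<open>e_0 - e_1\<close> and \<open>e_1\<close> are \<open>y 0\<close> and
  \<open>y 0 + y 1\<close>, and
  \<open>y 0 * (X - A) + (y 0 + y 1) * A = y 0 * X + y 1 * A\<close>.\<close>

lemma F1_isomorphic_fps_alg:
  assumes n: "n \<ge> 3"
  shows "isomorphic (F1 n \<alpha> (\<alpha> n)) (fps_alg n (fps_X - F1_series \<alpha>) (F1_series \<alpha>))"
proof -
  let ?L = "F1 n \<alpha> (\<alpha> n)" and ?M = "fps_alg n (fps_X - F1_series \<alpha>) (F1_series \<alpha>)"
  let ?f = "F1_coords n"
  define g where "g = (\<lambda>w :: complex \<times> complex fps. \<lambda>i. if i = 0 then fst w else
    if i \<le> n then snd w $ (i - 1) - (if i = 1 then fst w else 0) else 0)"
  have "bij_betw ?f (carrier ?L) (carrier ?M)"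
  proof (rule bij_betw_byWitness[where f' = g])
    show "\<forall>v\<in>carrier ?L. g (?f v) = v"
      using n by (auto simp: F1_def g_def fun_eq_iff)
    show "\<forall>w\<in>carrier ?M. ?f (g w) = w"
    proof
      fix w assume "w \<in> carrier ?M"
      then have "snd w $ i = 0" if "i \<ge> n" for i
        using that by (metis fps_alg_simps(1) fps_cutoff_nth not_le)
      then show "?f (g w) = w"
        using n by (auto simp: prod_eq_iff fps_eq_iff g_def)
    qed
    show "?f ` carrier ?L \<subseteq> carrier ?M" by (auto simp: fps_eq_iff)
    show "g ` carrier ?M \<subseteq> carrier ?L" using n by (auto simp: F1_def g_def)
  qed
  moreover have "linear_on ?L ?M ?f"
    by (auto simp: linear_on_def F1_def scale_fun_def prod_eq_iff fps_eq_iff algebra_simps)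
  moreover have "?f (bracket ?L x y) = bracket ?M (?f x) (?f y)" for x y
  proof -
    have e: "fps_const (y 0) * (fps_X - F1_series \<alpha>) + fps_const (y 0 + y 1) * F1_series \<alpha>
        = fps_const (y 0) * fps_X + fps_const (y 1) * F1_series \<alpha>"
      unfolding fps_const_add[symmetric] by (simp only: algebra_simps)
    have "snd (?f (bracket ?L x y)) $ l = snd (bracket ?M (?f x) (?f y)) $ l" for l
      using F1_bracket_Suc[OF n, of l \<alpha> x y] F1_bracket_outside[OF n, of 0 \<alpha> x y] n
      by (simp add: e[simplified])
    then show ?thesis
      using F1_bracket_outside[OF n, of 0 \<alpha> x y] by (simp add: prod_eq_iff fps_eq_iff)
  qed
  ultimately show ?thesis unfolding isomorphic_def by blast
qed

text \<open>The series \<open>A = F1_series \<alpha>\<close> starts in degree 2 or later, so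
  \<open>X - A\<close> is invertible under composition; substituting its inverse turns it into
  \<open>X\<close>.\<close>

lemma F1_isomorphic_fps_alg_X:
  fixes \<alpha> :: "nat \<Rightarrow> complex"
  assumes n: "n \<ge> 3"
  defines "g \<equiv> fps_inv (fps_X - F1_series \<alpha>)"
  shows "isomorphic (F1 n \<alpha> (\<alpha> n)) (fps_alg n fps_X (F1_series \<alpha> oo g))"
proof -
  let ?u = "fps_X - F1_series \<alpha>"
  have u: "?u $ 0 = 0" "?u $ 1 = 1" by simp_all
  have g: "g $ 0 = 0" "g $ 1 \<noteq> 0" by (simp_all add: g_def fps_inv_def)
  have "?u oo g = fps_X" unfolding g_def using u by (intro fps_inv_right) auto
  then show ?thesis
    using isomorphic_trans[OF F1_isomorphic_fps_alg[OF n]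
        fps_alg_change_variable[OF _ g, of n ?u "F1_series \<alpha>"]] n by simp
qed

text \<open>The Catalan parameters are the coefficients of \<open>X - w\<close>, where
  \<open>w\<close> inverts \<open>G = X + X ^ p\<close> and \<open>p = s - 1\<close>. So the new
  variable is \<open>w\<close>, and \<open>(X - w) oo G = G - X = X ^ p\<close>.\<close>

lemma F1s_isomorphic_fps_alg:
  assumes s: "3 \<le> s" "s \<le> n"
  shows "isomorphic (F1s n s) (fps_alg n fps_X (fps_X ^ (s - 1)))"
proof -
  define p where "p = s - 1"
  have p: "p \<ge> 2" "s = p + 1" using s by (auto simp: p_def)
  define G :: "complex fps" where "G = fps_X + fps_X ^ p"
  define w where "w = fps_inv G"
  have G: "G $ 0 = 0" "G $ 1 \<noteq> 0" using p by (simp_all add: G_def)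
  have wn: "w $ j = (if p - 1 dvd j - 1
           then (-1) ^ ((j - 1) div (p - 1)) * catalan p ((j - 1) div (p - 1)) else 0)" if "j \<ge> 1" for j
    unfolding w_def G_def by (rule fps_inv_X_plus_X_power_nth[OF p(1) that])
  have w0: "w $ 0 = 0" by (simp add: w_def fps_inv_def)
  have w1: "w $ Suc 0 = 1" using wn[of 1] by (simp add: catalan_def)
  have "F1_series (catalan_param s) $ j = (fps_X - w) $ j" for j
  proof (cases "j \<ge> 2")
    case False
    then have "j = 0 \<or> j = 1" by auto
    then show ?thesis using w0 w1 by auto
  next
    case True
    have c: "[j + 1 = s] (mod s - 2) \<longleftrightarrow> p - 1 dvd j - 1"
    proof -
      have "[j + 1 = s] (mod s - 2) \<longleftrightarrow> [(j - 1) + 2 = (p - 1) + 2] (mod p - 1)"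
        using True p by simp
      also have "\<dots> \<longleftrightarrow> [j - 1 = p - 1] (mod p - 1)"
        by (simp only: cong_add_rcancel_nat)
      also have "\<dots> \<longleftrightarrow> p - 1 dvd j - 1"
        by (simp add: cong_def mod_eq_0_iff_dvd)
      finally show ?thesis .
    qed
    show ?thesis
    proof (cases "p - 1 dvd j - 1")
      case False
      then show ?thesis using True c wn[of j] by (simp add: catalan_param_def)
    next
      case d: True
      \<comment> \<open>The parameter at index \<open>j + 1\<close> has \<open>t = m - 1\<close>.
        This shift gives the Catalan index \<open>t + 1\<close>, and the minus sign of
        \<open>X - w\<close> turns \<open>(-1) ^ (t + 1)\<close> into
        \<open>(-1) ^ t\<close>.\<close>
      then obtain m where m: "j - 1 = (p - 1) * m" by (elim dvdE)
      with True have "m \<noteq> 0" by (intro notI) simp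
      then obtain t where t: "m = Suc t" by (cases m) auto
      have "j + 1 - s = (p - 1) * t" using m t p True by simp
      then have q: "(j + 1 - s) div (s - 2) = t" using p by simp
      have "(j - 1) div (p - 1) = Suc t"
        unfolding m t using p by (intro nonzero_mult_div_cancel_left) simp
      then show ?thesis using True d c wn[of j] q p
        by (simp add: catalan_param_def Let_def)
    qed
  qed
  then have A: "F1_series (catalan_param s) = fps_X - w" by (simp add: fps_eq_iff)
  have "fps_inv w = G" unfolding w_def using G by (intro fps_inv_idempotent)
  moreover have "(fps_X - w) oo G = fps_X ^ p"
    using fps_inv[OF G] G by (simp add: fps_compose_sub_distrib w_def) (simp add: G_def)
  ultimately show ?thesis
    using F1_isomorphic_fps_alg_X[of n "catalan_param s"] s
    by (simp add: F1s_def A p_def)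
qed

theorem theorem3p6:
  fixes n :: nat
  assumes "n \<ge> 3"
  shows
    "(\<forall>(L :: (complex, 'v::ab_group_add) alg) \<alpha>.
        leibniz_algebra L \<and> filiform L \<and> non_characteristically_nilpotent L \<and>
        isomorphic L (F1 n \<alpha> (\<alpha> n)) \<and> (\<exists>k\<in>{3..n}. \<alpha> k \<noteq> 0) \<longrightarrow>
        (\<exists>s\<in>{3..n}. isomorphic L (F1s n s))) \<and>
     (\<forall>s\<in>{3..n}. \<forall>t\<in>{3..n}. s \<noteq> t \<longrightarrow> \<not> isomorphic (F1s n s) (F1s n t))"
proof (intro conjI allI impI ballI)
  fix L :: "(complex, 'v) alg" and \<alpha>
  assume "leibniz_algebra L \<and> filiform L \<and> non_characteristically_nilpotent L \<and>
    isomorphic L (F1 n \<alpha> (\<alpha> n)) \<and> (\<exists>k\<in>{3..n}. \<alpha> k \<noteq> 0)"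
  then obtain k d where L: "leibniz_algebra L" and iso: "isomorphic L (F1 n \<alpha> (\<alpha> n))"
    and k: "k \<in> {3..n}" "\<alpha> k \<noteq> 0" and d: "derivation L d" "\<not> nilpotent_map L d"
    by (auto simp: non_characteristically_nilpotent_def)
  define A where "A = F1_series \<alpha>"
  define u where "u = fps_X - A"
  define g where "g = fps_inv u"
  define B where "B = A oo g"
  have u: "u $ 0 = 0" "u $ 1 \<noteq> 0" by (simp_all add: u_def A_def)
  have g0: "g $ 0 = 0" by (simp add: g_def fps_inv_def)
  have LB: "isomorphic L (fps_alg n fps_X B)"
    using isomorphic_trans[OF iso F1_isomorphic_fps_alg_X[OF assms]]
    by (simp add: B_def A_def g_def u_def)
  obtain d' where d': "derivation (fps_alg n fps_X B) d'" "\<not> nilpotent_map (fps_alg n fps_X B) d'"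
    using derivation_transfer[OF leibniz_algebra_closed[OF L] LB d] by blast
  have B0: "B $ 0 = 0" by (simp add: B_def A_def)
  have B1: "B $ 1 = 0" by (simp add: B_def A_def fps_compose_nth)
  have kn: "2 \<le> k - 1" "k - 1 < n" using k(1) by auto
  \<comment> \<open>Substituting back recovers \<open>A\<close>, so a nonzero
    \<open>\<alpha> k\<close> with \<open>k \<le> n\<close> keeps \<open>B\<close> nonzero modulo
    \<open>X ^ n\<close>.\<close>
  have "B oo u = A"
    using fps_compose_assoc[OF u(1) g0, of A] fps_inv[OF u] by (simp add: B_def g_def)
  then have "fps_cutoff n (fps_cutoff n B oo u) $ (k - 1) = \<alpha> k"
    using k kn by (simp add: fps_cutoff_compose u A_def)
  then have "fps_cutoff n B \<noteq> 0"
    using k(2) by (metis fps_compose_0 fps_cutoff_zero fps_zero_nth)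
  then obtain i where i: "i < n" "B $ i \<noteq> 0"
    by (auto simp: fps_eq_iff split: if_splits)
  have i2: "i \<ge> 2"
  proof (rule ccontr)
    assume "\<not> i \<ge> 2"
    then have "i = 0 \<or> i = 1" by auto
    then show False using i B0 B1 by auto
  qed
  have "fps_cutoff n B = fps_cutoff n (fps_const (B $ i) * fps_X ^ i)"
    using assms by (intro fps_alg_derivation_nilpotent_or_monomial[OF _ B0 B1 d' i]) simp
  from fps_alg_cong[OF this] LB
  have "isomorphic L (fps_alg n fps_X (fps_const (B $ i) * fps_X ^ i))" by simp
  then have "isomorphic L (fps_alg n fps_X (fps_X ^ i))"
    using isomorphic_trans fps_alg_scale[OF i(2)] by blast
  \<comment> \<open>The exponent in the model of \<open>F1s n s\<close> is \<open>s - 1\<close>,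
    hence \<open>s = i + 1\<close>.\<close>
  moreover have s: "Suc i \<in> {3..n}" using i i2 by auto
  have "isomorphic (fps_alg n fps_X (fps_X ^ i)) (F1s n (Suc i))"
    using isomorphic_sym[OF _ F1s_isomorphic_fps_alg[of "Suc i" n]] s closed_F1[OF assms]
    by (simp add: F1s_def)
  ultimately have "isomorphic L (F1s n (Suc i))" by (rule isomorphic_trans)
  then show "\<exists>s\<in>{3..n}. isomorphic L (F1s n s)" using s by blast
next
  fix s t assume s: "s \<in> {3..n}" and t: "t \<in> {3..n}" and st: "s \<noteq> t"
  show "\<not> isomorphic (F1s n s) (F1s n t)"
  proof
    assume "isomorphic (F1s n s) (F1s n t)"
    moreover have "isomorphic (fps_alg n fps_X (fps_X ^ (s - 1))) (F1s n s)"
      using isomorphic_sym[OF _ F1s_isomorphic_fps_alg[of s n]] s closed_F1[OF assms]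
      by (simp add: F1s_def)
    ultimately have "isomorphic (fps_alg n fps_X (fps_X ^ (s - 1))) (fps_alg n fps_X (fps_X ^ (t - 1)))"
      using F1s_isomorphic_fps_alg[of t n] t isomorphic_trans by (metis atLeastAtMost_iff)
    moreover have "2 \<le> s - 1" "s - 1 < n" "2 \<le> t - 1" "t - 1 < n" "s - 1 \<noteq> t - 1"
      using s t st by auto
    from fps_alg_X_power_not_isomorphic[OF this]
    have "\<not> isomorphic (fps_alg n fps_X (fps_X ^ (s - 1))) (fps_alg n fps_X (fps_X ^ (t - 1)))" .
    ultimately show False by contradiction
  qed
qed

end
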